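(* Let $T = [0,1]$ (the real unit interval) be the semiring equipped with addition $a \oplus b = \max(a,b)$ and multiplication defined by $a \odot b = 0$ for all $a,b \in [0,1)$, with $1 \odot a = a \odot 1 = a$ for all $a \in T$. The subtractive closure operator $\operatorname{scl}_T$ on the lattice of ideals of $T$ is not a nucleus map.
   Context: The additive identity (zero) of $T$ is the number $0$ and the multiplicative identity is the number $1$. An ideal of a commutative semiring $S$ (with operations $+,\cdot$) is a nonempty subset $I$ with $a+b\in I$ and $sa\in I$ for all $a,b\in I$, $s\in S$. An ideal $I$ is subtractive if $x+y\in I$ and $x\in I$ imply $y\in I$, for all $x,y\in S$. $\operatorname{scl}_S(I)$ is the intersection of all subtractive ideals of $S$ containing $I$. The ideals of $S$ form a lattice under inclusion, with meet given by intersection. A nucleus map on a meet-semilattice $(P,\le)$ is a function $\nu:P\to P$ such that for all $x,y\in P$: $x\le\nu(x)$; $\nu(\nu(x))=\nu(x)$; $\nu(x\wedge y)=\nu(x)\wedge\nu(y)$. *)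

theory Defs
  imports Complex_Main "HOL-Algebra.Ring" "HOL-Algebra.Lattice"
begin

definition T :: "real ring" where
  "T = \<lparr>carrier = {0..1},
        mult = (\<lambda>a b. if a = 1 then b else if b = 1 then a else 0),
        one = 1, zero = 0, add = max\<rparr>"

definition semiring_ideal :: "('a, 'm) ring_scheme \<Rightarrow> 'a set \<Rightarrow> bool" where
  "semiring_ideal S I \<longleftrightarrow> I \<subseteq> carrier S \<and> I \<noteq> {} \<and>
     (\<forall>a\<in>I. \<forall>b\<in>I. a \<oplus>\<^bsub>S\<^esub> b \<in> I) \<and> (\<forall>s\<in>carrier S. \<forall>a\<in>I. s \<otimes>\<^bsub>S\<^esub> a \<in> I)"

definition subtractive_ideal :: "('a, 'm) ring_scheme \<Rightarrow> 'a set \<Rightarrow> bool" where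
  "subtractive_ideal S I \<longleftrightarrow> semiring_ideal S I \<and>
     (\<forall>x\<in>carrier S. \<forall>y\<in>carrier S. x \<oplus>\<^bsub>S\<^esub> y \<in> I \<longrightarrow> x \<in> I \<longrightarrow> y \<in> I)"

definition scl :: "('a, 'm) ring_scheme \<Rightarrow> 'a set \<Rightarrow> 'a set" where
  "scl S I = \<Inter>{J. subtractive_ideal S J \<and> I \<subseteq> J}"

definition ideal_lattice :: "('a, 'm) ring_scheme \<Rightarrow> 'a set gorder" where
  "ideal_lattice S = \<lparr>carrier = {I. semiring_ideal S I}, eq = (=), le = (\<subseteq>)\<rparr>"

text \<open>The following is meant for \<^term>\<open>L\<close> a \<^locale>\<open>lower_semilattice\<close>.\<close>

definition nucleus :: "('a, 'm) gorder_scheme \<Rightarrow> ('a \<Rightarrow> 'a) \<Rightarrow> bool" where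
  "nucleus L \<nu> \<longleftrightarrow> \<nu> \<in> carrier L \<rightarrow> carrier L \<and>
     (\<forall>x\<in>carrier L. \<forall>y\<in>carrier L.
        x \<sqsubseteq>\<^bsub>L\<^esub> \<nu> x \<and> \<nu> (\<nu> x) = \<nu> x \<and> \<nu> (x \<sqinter>\<^bsub>L\<^esub> y) = \<nu> x \<sqinter>\<^bsub>L\<^esub> \<nu> y)"

text \<open>The facts below show that the definitions are used as intended: \<^term>\<open>T\<close> is a commutative
  semiring, the ideals of a semiring form a lattice whose meet is intersection, and
  \<^const>\<open>scl\<close> maps ideals to ideals.\<close>

lemma semiring_T: "semiring T"
  by unfold_locales (auto simp: T_def max_def)

lemma comm_monoid_T: "comm_monoid T"
  by unfold_locales (auto simp: T_def)

lemma zero_mem_semiring_ideal: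
  assumes "semiring S" "semiring_ideal S I"
  shows "\<zero>\<^bsub>S\<^esub> \<in> I"
proof -
  interpret semiring S by fact
  obtain a where a: "a \<in> I" "a \<in> carrier S"
    using assms(2) by (auto simp: semiring_ideal_def)
  then have "\<zero>\<^bsub>S\<^esub> \<otimes>\<^bsub>S\<^esub> a \<in> I"
    using assms(2) zero_closed by (auto simp: semiring_ideal_def simp del: l_null)
  with a show ?thesis by simp
qed

lemma semiring_ideal_carrier:
  assumes "semiring S"
  shows "semiring_ideal S (carrier S)"
proof -
  interpret semiring S by fact
  show ?thesis by (auto simp: semiring_ideal_def)
qed

lemma semiring_ideal_Inter:
  assumes "semiring S" "A \<noteq> {}" "\<And>I. I \<in> A \<Longrightarrow> semiring_ideal S I"
  shows "semiring_ideal S (\<Inter>A)"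
proof -
  have "\<zero>\<^bsub>S\<^esub> \<in> \<Inter>A"
    using assms zero_mem_semiring_ideal by blast
  moreover have "\<Inter>A \<subseteq> carrier S"
    using assms(2,3) unfolding semiring_ideal_def by (meson Inter_lower ex_in_conv subset_trans)
  ultimately show ?thesis
    using assms(3) by (auto simp: semiring_ideal_def)
qed

lemma ideal_lattice_greatest:
  assumes "semiring S" "semiring_ideal S I" "semiring_ideal S J"
  shows "greatest (ideal_lattice S) K (Lower (ideal_lattice S) {I, J}) \<longleftrightarrow> K = I \<inter> J"
proof -
  have "semiring_ideal S (I \<inter> J)"
    using semiring_ideal_Inter[of S "{I, J}"] assms by auto
  moreover have "Lower (ideal_lattice S) {I, J} = {K. semiring_ideal S K \<and> K \<subseteq> I \<inter> J}"
    using assms(2,3) by (auto simp: Lower_def ideal_lattice_def)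
  ultimately show ?thesis
    by (simp add: greatest_def ideal_lattice_def) blast
qed

lemma lattice_ideal_lattice:
  assumes "semiring S"
  shows "lattice (ideal_lattice S)"
proof
  fix I J assume IJ: "I \<in> carrier (ideal_lattice S)" "J \<in> carrier (ideal_lattice S)"
  then have ideals: "semiring_ideal S I" "semiring_ideal S J"
    by (simp_all add: ideal_lattice_def)
  let ?K = "\<Inter>{K. semiring_ideal S K \<and> I \<union> J \<subseteq> K}"
  have "carrier S \<in> {K. semiring_ideal S K \<and> I \<union> J \<subseteq> K}"
    using semiring_ideal_carrier[OF assms] ideals by (auto simp: semiring_ideal_def)
  then have "semiring_ideal S ?K"
    by (intro semiring_ideal_Inter[OF assms]) auto
  then have "least (ideal_lattice S) ?K (Upper (ideal_lattice S) {I, J})"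
    using ideals unfolding least_def Upper_def ideal_lattice_def by auto
  then show "\<exists>s. least (ideal_lattice S) s (Upper (ideal_lattice S) {I, J})" ..
  show "\<exists>s. greatest (ideal_lattice S) s (Lower (ideal_lattice S) {I, J})"
    using ideal_lattice_greatest[OF assms ideals] by blast
qed (auto simp: ideal_lattice_def)

lemma meet_ideal_lattice:
  assumes "semiring S" "semiring_ideal S I" "semiring_ideal S J"
  shows "I \<sqinter>\<^bsub>ideal_lattice S\<^esub> J = I \<inter> J"
  using ideal_lattice_greatest[OF assms] by (simp add: meet_def inf_def)

lemma semiring_ideal_scl:
  assumes "semiring S" "semiring_ideal S I"
  shows "semiring_ideal S (scl S I)"
proof -
  have "subtractive_ideal S (carrier S)"
    using semiring_ideal_carrier[OF assms(1)] by (simp add: subtractive_ideal_def)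
  moreover have "I \<subseteq> carrier S"
    using assms(2) by (simp add: semiring_ideal_def)
  ultimately show ?thesis
    unfolding scl_def
    by (intro semiring_ideal_Inter[OF assms(1)]) (auto simp: subtractive_ideal_def)
qed

end

theory Submission
  imports Defs
begin

text \<open>Every set \<open>{0, a}\<close> with \<open>a < 1\<close> is an ideal of \<open>T\<close>, whereas subtractive ideals are
  closed downwards. So the ideals \<open>{0, 1/2}\<close> and \<open>{0, 1/4}\<close> meet in the subtractive ideal
  \<open>{0}\<close>, but \<open>1/4\<close> lies in both of their closures.\<close>

text \<open>As \<open>a < 1\<close>, a multiple of \<open>a\<close> is \<open>a\<close> itself (by
  the factor 1) or 0, and \<open>max\<close> never leaves a chain.\<close>

lemma semiring_ideal_T_pair:
  assumes "0 \<le> a" "a < 1"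
  shows "semiring_ideal T {0, a}"
  using assms by (auto simp: semiring_ideal_def T_def)

lemma subtractive_ideal_T_zero: "subtractive_ideal T {0}"
  by (auto simp: subtractive_ideal_def semiring_ideal_def T_def max_def)

text \<open>Addition is \<open>max\<close>, so \<open>b\<close> is absorbed by \<open>a\<close>: the
  sum is \<open>a\<close>, and subtractivity cancels the summand \<open>a\<close>.\<close>

lemma scl_T_downward_closed:
  assumes "a \<in> I" "a \<le> 1" "0 \<le> b" "b \<le> a"
  shows "b \<in> scl T I"
  unfolding scl_def
proof (intro InterI, clarify)
  fix J assume J: "subtractive_ideal T J" "I \<subseteq> J"
  have "a \<in> carrier T" "b \<in> carrier T" "a \<oplus>\<^bsub>T\<^esub> b = a"
    using assms by (auto simp: T_def)
  then show "b \<in> J"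
    using J assms(1) unfolding subtractive_ideal_def by (metis subsetD)
qed

theorem theorem4p6:
  shows "\<not> nucleus (ideal_lattice T) (scl T)"
proof
  assume nucleus: "nucleus (ideal_lattice T) (scl T)"
  let ?I = "{0, 1/2 :: real}" and ?J = "{0, 1/4 :: real}"
  have ideals: "semiring_ideal T ?I" "semiring_ideal T ?J"
    by (simp_all add: semiring_ideal_T_pair)
  then have "scl T (?I \<sqinter>\<^bsub>ideal_lattice T\<^esub> ?J) = scl T ?I \<sqinter>\<^bsub>ideal_lattice T\<^esub> scl T ?J"
    using nucleus by (simp add: nucleus_def ideal_lattice_def)
  then have "scl T (?I \<inter> ?J) = scl T ?I \<inter> scl T ?J"
    using ideals by (simp only: meet_ideal_lattice semiring_T semiring_ideal_scl)
  moreover have "1/4 \<in> scl T ?I" "1/4 \<in> scl T ?J"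
    by (auto intro: scl_T_downward_closed[of "1/2"] scl_T_downward_closed[of "1/4"])
  \<comment> \<open>\<open>?I \<inter> ?J\<close> is \<open>{0}\<close>, which is itself among the
    subtractive ideals intersected in \<open>scl\<close>.\<close>
  moreover have "scl T (?I \<inter> ?J) \<subseteq> {0}"
    using subtractive_ideal_T_zero by (auto simp: scl_def)
  ultimately show False by auto
qed

end
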